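(* Let $p$ be a prime, let $E=\{s_n\}_{n\in\mathbb{N}}\subset\overline{\mathbb{Q}_p}$ be a stacked sequence and let $W=\mathbb{Z}_{p,E}$. For each $n$ let $\Gamma_n$ and $k_n$ be the value group and the residue field of $\mathbb{Q}_p(s_n)$ (with respect to $v_p$), and let $\Gamma_w$ and $k_w$ be the value group and residue field of $W$. Then $$\bigcup_{n\in\mathbb{N}}\Gamma_n=\Gamma_w,\qquad \bigcup_{n\in\mathbb{N}}k_n=k_w.$$
   Context: $\overline{\mathbb{Q}_p}$ is a fixed algebraic closure of $\mathbb{Q}_p$, $v_p$ is the $p$-adic valuation extended uniquely to $\overline{\mathbb{Q}_p}$ (with $v_p(p)=1$), and $\overline{\mathbb{Z}_p}$ is its valuation ring. $\mathbb{N}=\{0,1,2,\dots\}$. A sequence $E=\{s_n\}_{n\ge0}\subset\overline{\mathbb{Q}_p}$ with $s_0\in\mathbb{Q}_p$ is stacked if for every $n\ge0$: (i) $[\mathbb{Q}_p(s_n):\mathbb{Q}_p]<[\mathbb{Q}_p(s_{n+1}):\mathbb{Q}_p]$; and (iii) for every $c\in\overline{\mathbb{Q}_p}$ with $[\mathbb{Q}_p(c):\mathbb{Q}_p]<[\mathbb{Q}_p(s_n):\mathbb{Q}_p]$ one has $v_p(s_n-c)<v_p(s_{n+1}-s_n)$. $\mathbb{Z}_{p,E}=\{\phi\in\mathbb{Q}_p(X)\mid\phi(s_n)\in\overline{\mathbb{Z}_p}\text{ for all sufficiently large }n\}$; it is a valuation domain of $\mathbb{Q}_p(X)$ extending $\mathbb{Z}_p$,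 and it is the contraction to $\mathbb{Q}_p(X)$ of the valuation domain $\overline{\mathbb{Z}_p}_E=\{\phi\in\overline{\mathbb{Q}_p}(X)\mid\phi(s_n)\in\overline{\mathbb{Z}_p}\text{ for all sufficiently large }n\}$ of $\overline{\mathbb{Q}_p}(X)$, which extends $\overline{\mathbb{Z}_p}$ with the same value group $\mathbb{Q}$ and the same residue field. The valuation $w$ of $W$ is normalized so that it extends $v_p$; $\Gamma_n,\Gamma_w$ are regarded as subgroups of $\mathbb{Q}$, and $k_n,k_w$ as subfields of the residue field of $\overline{\mathbb{Z}_p}_E$. *)

theory Defs
  imports "HOL-Algebra.Algebraic_Closure_Type" "HOL-Algebra.Generated_Fields" "HOL-Computational_Algebra.Computational_Algebra"
begin

section \<open>Valuations with values in the rational numbers\<close>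

text \<open>
  A valuation is a \<^typ>\<open>rat\<close>-valued function whose value at 0 (conventionally infinity) is
  irrelevant: every definition below treats 0 separately or only evaluates valuations at nonzero
  elements. The first argument is the subfield carrying the valuation.
\<close>

definition valuation_on :: "'a::field set \<Rightarrow> ('a \<Rightarrow> rat) \<Rightarrow> bool" where
  "valuation_on F u \<longleftrightarrow>
     (\<forall>x\<in>F. \<forall>y\<in>F. x \<noteq> 0 \<longrightarrow> y \<noteq> 0 \<longrightarrow> u (x * y) = u x + u y) \<and>
     (\<forall>x\<in>F. \<forall>y\<in>F. x \<noteq> 0 \<longrightarrow> y \<noteq> 0 \<longrightarrow> x + y \<noteq> 0 \<longrightarrow> min (u x) (u y) \<le> u (x + y))"

definition valuation_ring :: "'a::field set \<Rightarrow> ('a \<Rightarrow> rat) \<Rightarrow> 'a set" where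
  "valuation_ring F u = {x \<in> F. x = 0 \<or> 0 \<le> u x}"

definition value_group :: "'a::field set \<Rightarrow> ('a \<Rightarrow> rat) \<Rightarrow> rat set" where
  "value_group F u = u ` (F - {0})"


section \<open>The field of p-adic numbers\<close>

definition val_close :: "('a::field \<Rightarrow> rat) \<Rightarrow> rat \<Rightarrow> 'a \<Rightarrow> 'a \<Rightarrow> bool" where
  "val_close u N x y \<longleftrightarrow> x = y \<or> N \<le> u (x - y)"

text \<open>
  The field \<open>'k\<close> with the valuation \<open>u\<close> is a completion of the rational numbers with respect to
  the p-adic valuation. This determines the pair up to unique isomorphism.
\<close>

definition is_padic_field :: "nat \<Rightarrow> ('k::field_char_0 \<Rightarrow> rat) \<Rightarrow> bool" where
  "is_padic_field p u \<longleftrightarrow>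
     valuation_on UNIV u \<and>
     (\<forall>n::int. n \<noteq> 0 \<longrightarrow> u (of_int n) = of_nat (multiplicity (int p) n)) \<and>
     (\<forall>x N. \<exists>q::rat. val_close u N x (of_rat q)) \<and>
     (\<forall>a :: nat \<Rightarrow> 'k.
        (\<forall>N. \<exists>M. \<forall>m\<ge>M. \<forall>n\<ge>M. val_close u N (a m) (a n)) \<longrightarrow>
        (\<exists>l. \<forall>N. \<exists>M. \<forall>n\<ge>M. val_close u N (a n) l))"


section \<open>Simple extensions inside the algebraic closure\<close>

definition adjoin :: "'k::field alg_closure \<Rightarrow> 'k alg_closure set" where
  "adjoin x = generate_field ring_of_type_algebra (insert x (range to_ac))"

definition ext_degree :: "'k::field alg_closure \<Rightarrow> nat" where
  "ext_degree x = vector_space.dim (\<lambda>(c::'k) y. to_ac c * y) (adjoin x)"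


section \<open>Stacked sequences\<close>

text \<open>
  By the degree conditions, the differences to which \<open>v\<close> is applied here are nonzero.
\<close>

definition stacked :: "('k::field alg_closure \<Rightarrow> rat) \<Rightarrow> (nat \<Rightarrow> 'k alg_closure) \<Rightarrow> bool" where
  "stacked v s \<longleftrightarrow>
     s 0 \<in> range to_ac \<and>
     (\<forall>n. ext_degree (s n) < ext_degree (s (Suc n))) \<and>
     (\<forall>n c. ext_degree c < ext_degree (s n) \<longrightarrow> v (s n - c) < v (s (Suc n) - s n))"


section \<open>Rational functions and the rings attached to a sequence\<close>

definition ratfun_const :: "'a::field \<Rightarrow> 'a poly fract" where
  "ratfun_const c = Fract [:c:] 1"

text \<open>The rational functions over the base field, inside those over its algebraic closure.\<close>

definition base_ratfuns :: "'k::field alg_closure poly fract set" where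
  "base_ratfuns = {Fract (map_poly to_ac a) (map_poly to_ac b) | a b :: 'k poly. b \<noteq> 0}"

text \<open>\<open>has_value \<phi> x y\<close>: the rational function \<open>\<phi>\<close> has no pole at \<open>x\<close> and takes the value \<open>y\<close> there.\<close>

definition has_value :: "'a::field poly fract \<Rightarrow> 'a \<Rightarrow> 'a \<Rightarrow> bool" where
  "has_value \<phi> x y \<longleftrightarrow> (\<exists>a b. \<phi> = Fract a b \<and> poly b x \<noteq> 0 \<and> y = poly a x / poly b x)"

definition seq_ring_closure ::
  "('k::field alg_closure \<Rightarrow> rat) \<Rightarrow> (nat \<Rightarrow> 'k alg_closure) \<Rightarrow> 'k alg_closure poly fract set" where
  "seq_ring_closure v s =
     {\<phi>. \<forall>\<^sub>F n in sequentially. \<exists>y \<in> valuation_ring UNIV v. has_value \<phi> (s n) y}"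

definition seq_ring ::
  "('k::field alg_closure \<Rightarrow> rat) \<Rightarrow> (nat \<Rightarrow> 'k alg_closure) \<Rightarrow> 'k alg_closure poly fract set" where
  "seq_ring v s =
     {\<phi> \<in> base_ratfuns. \<forall>\<^sub>F n in sequentially. \<exists>y \<in> valuation_ring UNIV v. has_value \<phi> (s n) y}"


section \<open>Residue fields\<close>

definition ring_on :: "'a::field set \<Rightarrow> 'a ring" where
  "ring_on V = ring_of_type_algebra\<lparr>carrier := V\<rparr>"

text \<open>The maximal ideal of a valuation ring \<open>V\<close>.\<close>

definition nonunits :: "'a::field set \<Rightarrow> 'a set" where
  "nonunits V = V - Units (ring_on V)"

text \<open>
  If \<open>V\<close> is a valuation ring and \<open>B \<subseteq> V\<close> is the contraction of \<open>V\<close> to a subfield, then the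
  residue field of \<open>B\<close> is regarded as a subfield of the residue field
  \<open>ring_on V Quot nonunits V\<close> of \<open>V\<close>, namely as the image of \<open>B\<close> under the quotient map.
\<close>

definition residue_image :: "'a::field set \<Rightarrow> 'a set \<Rightarrow> 'a set set" where
  "residue_image V B = (\<lambda>x. nonunits V +>\<^bsub>ring_on V\<^esub> x) ` B"

definition residue_field_ext ::
  "('k::field alg_closure \<Rightarrow> rat) \<Rightarrow> (nat \<Rightarrow> 'k alg_closure) \<Rightarrow> nat
     \<Rightarrow> 'k alg_closure poly fract set set" where
  "residue_field_ext v s n =
     residue_image (seq_ring_closure v s) (ratfun_const ` valuation_ring (adjoin (s n)) v)"

definition residue_field_seq ::
  "('k::field alg_closure \<Rightarrow> rat) \<Rightarrow> (nat \<Rightarrow> 'k alg_closure)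
     \<Rightarrow> 'k alg_closure poly fract set set" where
  "residue_field_seq v s = residue_image (seq_ring_closure v s) (seq_ring v s)"

end

(*
  If c has degree less than that of s n, stacking gives v(s m - s n) > v(s n - c) for m > n, so
  (s m - c) / (s n - c) is a one-unit (congruent to 1 modulo the maximal ideal). Hence
  phi(s m) / phi(s n) is a one-unit for m >= n as soon as all zeros and poles of phi have degree
  less than that of s n. Such a phi has the value and the residue of phi(s n), which lies in
  Q_p(s n) if phi has coefficients in Q_p. Conversely, an element of Q_p(s n) is g(s n) with
  deg g < [Q_p(s n) : Q_p], so the zeros of g have small enough degree, and g has the value and
  the residue of g(s n).
*)
theory Submission
  imports Defs
begin

section \<open>Simple extensions\<close>

lemma map_poly_to_ac_add:
  "map_poly to_ac (f + g) = map_poly to_ac f + map_poly to_ac (g :: 'k::field poly)"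
  by (rule poly_eqI) (simp add: coeff_map_poly)

lemma map_poly_to_ac_mult:
  "map_poly to_ac (f * g) = map_poly to_ac f * map_poly to_ac (g :: 'k::field poly)"
  by (rule poly_eqI) (simp add: coeff_map_poly coeff_mult to_ac_sum)

lemma map_poly_to_ac_eq_0_iff [simp]:
  "map_poly to_ac f = 0 \<longleftrightarrow> f = (0 :: 'k::field poly)"
  by (rule map_poly_eq_0_iff) auto

definition ac_eval :: "'k::field poly \<Rightarrow> 'k alg_closure \<Rightarrow> 'k alg_closure" where
  "ac_eval f x = poly (map_poly to_ac f) x"

lemma ac_eval_0 [simp]: "ac_eval 0 x = 0"
  and ac_eval_add: "ac_eval (f + g) x = ac_eval f x + ac_eval g x"
  and ac_eval_mult: "ac_eval (f * g) x = ac_eval f x * ac_eval g x"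
  and ac_eval_pCons: "ac_eval (pCons c f) x = to_ac c + x * ac_eval f x"
  by (simp_all add: ac_eval_def map_poly_to_ac_add map_poly_to_ac_mult map_poly_pCons)

text \<open>A bound \<open>d\<close> independent of \<open>f\<close> turns all polynomials of degree
  below \<open>d\<close> into combinations of the same powers of \<open>x\<close>.\<close>

lemma ac_eval_altdef:
  assumes "degree f < d"
  shows "ac_eval f x = (\<Sum>i<d. to_ac (coeff f i) * x ^ i)"
proof -
  have "ac_eval f x = (\<Sum>i\<le>degree f. to_ac (coeff f i) * x ^ i)"
    by (simp add: ac_eval_def poly_altdef degree_map_poly coeff_map_poly)
  also have "\<dots> = (\<Sum>i<d. to_ac (coeff f i) * x ^ i)"
    using assms by (intro sum.mono_neutral_left) (auto simp: coeff_eq_0 not_le)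
  finally show ?thesis .
qed

text \<open>Algebraicity provides an annihilating polynomial, and one of least degree is chosen.
  Minimality of the degree stands in for irreducibility.\<close>

lemma exists_minimal_polynomial:
  fixes x :: "'k::field alg_closure"
  obtains m where "m \<noteq> 0" "ac_eval m x = 0"
    "\<And>f. f \<noteq> 0 \<Longrightarrow> ac_eval f x = 0 \<Longrightarrow> degree m \<le> degree f"
proof -
  obtain q :: "'k poly" where "q \<noteq> 0" "ac_eval q x = 0"
    using alg_closure_algebraic unfolding ac_eval_def by metis
  then have "\<exists>m. (m \<noteq> 0 \<and> ac_eval m x = 0) \<and>
      (\<forall>f. f \<noteq> 0 \<and> ac_eval f x = 0 \<longrightarrow> degree m \<le> degree f)"
    using ex_has_least_nat[of "\<lambda>f. f \<noteq> 0 \<and> ac_eval f x = 0" q degree] by auto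
  then show ?thesis
    using that by blast
qed

section \<open>The field generated by one algebraic element\<close>

lemma adjoin_closed:
  fixes x :: "'k::field alg_closure"
  shows adjoin_base: "to_ac c \<in> adjoin x"
    and adjoin_generator: "x \<in> adjoin x"
    and adjoin_add: "y \<in> adjoin x \<Longrightarrow> z \<in> adjoin x \<Longrightarrow> y + z \<in> adjoin x"
    and adjoin_mult: "y \<in> adjoin x \<Longrightarrow> z \<in> adjoin x \<Longrightarrow> y * z \<in> adjoin x"
proof -
  let ?R = "ring_of_type_algebra :: 'k alg_closure ring"
  show "to_ac c \<in> adjoin x" "x \<in> adjoin x"
    by (auto simp: adjoin_def intro: generate_field.incl)
  show "y + z \<in> adjoin x" if "y \<in> adjoin x" "z \<in> adjoin x"
    using generate_field.eng_add[OF that[unfolded adjoin_def]]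
    by (simp add: adjoin_def ring_of_type_algebra_def)
  show "y * z \<in> adjoin x" if "y \<in> adjoin x" "z \<in> adjoin x"
    using generate_field.eng_mult[OF that[unfolded adjoin_def]]
    by (simp add: adjoin_def ring_of_type_algebra_def)
qed

text \<open>\<open>generate_field\<close> uses the operations of a ring record; this identifies its
  inverse with the one of the type class.\<close>

lemma ring_of_type_algebra_inv:
  assumes "(y :: 'a::field) \<noteq> 0"
  shows "inv\<^bsub>ring_of_type_algebra\<^esub> y = inverse y"
proof -
  interpret ring "ring_of_type_algebra :: 'a ring" by rule
  show ?thesis
    using inv_char[of y "inverse y"] assms by (simp add: ring_of_type_algebra_def)
qed

lemma ring_of_type_algebra_uminus:
  "\<ominus>\<^bsub>ring_of_type_algebra\<^esub> y = - (y :: 'a::field)"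
proof -
  interpret ring "ring_of_type_algebra :: 'a ring" by rule
  show ?thesis
    using minus_equality[of "- y" y] by (simp add: ring_of_type_algebra_def)
qed

lemma adjoin_inverse:
  assumes "y \<in> adjoin x"
  shows "inverse y \<in> adjoin x"
proof (cases "y = 0")
  case True
  then show ?thesis using assms by simp
next
  case False
  have "inv\<^bsub>ring_of_type_algebra\<^esub> y \<in> adjoin x"
    using generate_field.m_inv[OF assms[unfolded adjoin_def]] False
    by (simp add: adjoin_def ring_of_type_algebra_def)
  then show ?thesis using False by (simp add: ring_of_type_algebra_inv)
qed

lemma ac_eval_in_adjoin: "ac_eval f x \<in> adjoin x"
proof (induction f)
  case 0
  show ?case using adjoin_base[of 0] by simp
next
  case (pCons c f)
  then show ?case by (auto simp: ac_eval_pCons intro!: adjoin_closed)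
qed

text \<open>
  The inverse of an algebraic element is a polynomial in it, because its minimal polynomial has
  nonzero constant coefficient; so the polynomial expressions already form a field.
\<close>

lemma adjoin_eq_range_ac_eval: "adjoin x = range (\<lambda>f. ac_eval f x)"
proof
  show "range (\<lambda>f. ac_eval f x) \<subseteq> adjoin x"
    using ac_eval_in_adjoin by blast
  let ?S = "range (\<lambda>f. ac_eval f x)"
  have base: "to_ac c \<in> ?S" for c
    by (rule range_eqI[of _ _ "[:c:]"]) (simp add: ac_eval_pCons)
  have gen: "x \<in> ?S"
    by (rule range_eqI[of _ _ "[:0, 1:]"]) (simp add: ac_eval_pCons)
  have add: "y + z \<in> ?S" if "y \<in> ?S" "z \<in> ?S" for y z
    using that by (auto simp flip: ac_eval_add)
  have mult: "y * z \<in> ?S" if "y \<in> ?S" "z \<in> ?S" for y z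
    using that by (auto simp flip: ac_eval_mult)
  have uminus: "- y \<in> ?S" if "y \<in> ?S" for y
    using mult[OF base[of "-1"] that] by simp
  \<comment> \<open>The inverse of \<open>y\<close> will appear as a polynomial in \<open>y\<close>,
    so substituting expressions in \<open>x\<close> must not leave \<open>?S\<close>.\<close>
  have eval: "ac_eval f y \<in> ?S" if "y \<in> ?S" for f y
  proof (induction f)
    case 0
    show ?case using base[of 0] by simp
  next
    case (pCons c f)
    show ?case unfolding ac_eval_pCons by (intro add base mult pCons.IH that)
  qed
  have inv: "inverse y \<in> ?S" if y: "y \<in> ?S" "y \<noteq> 0" for y
  proof -
    obtain m where m: "m \<noteq> 0" "ac_eval m y = 0"
      and min: "\<And>f. f \<noteq> 0 \<Longrightarrow> ac_eval f y = 0 \<Longrightarrow> degree m \<le> degree f"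
      using exists_minimal_polynomial[of y] by blast
    obtain c h where h: "m = pCons c h" by (cases m)
    \<comment> \<open>Otherwise \<open>m\<close> is X times \<open>h\<close>, and as
      \<open>y\<close> is nonzero, \<open>h\<close> annihilates \<open>y\<close> in smaller
      degree.\<close>
    have "c \<noteq> 0"
    proof
      assume c: "c = 0"
      with m h have "h \<noteq> 0" by auto
      moreover have "ac_eval h y = 0" using m y h c by (simp add: ac_eval_pCons)
      ultimately show False using min[of h] h by simp
    qed
    have "y * ac_eval h y = - to_ac c"
      using m h by (simp add: ac_eval_pCons eq_neg_iff_add_eq_0 add.commute)
    then have "inverse y = to_ac (- inverse c) * ac_eval h y"
      using \<open>c \<noteq> 0\<close> y by (simp add: field_simps)
    then show ?thesis using mult[OF base eval[OF y(1)]] by (simp only:)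
  qed
  show "adjoin x \<subseteq> ?S"
  proof
    fix y assume "y \<in> adjoin x"
    then show "y \<in> ?S" unfolding adjoin_def
    proof (induction rule: generate_field.induct)
      case one
      show ?case using base[of 1] by (simp add: ring_of_type_algebra_def)
    next
      case (incl h)
      then show ?case using gen base by auto
    next
      case (a_inv h)
      then show ?case using uminus by (simp add: ring_of_type_algebra_uminus)
    next
      case (m_inv h)
      from m_inv.hyps have "h \<noteq> 0" by (simp add: ring_of_type_algebra_def)
      then show ?case using inv m_inv.IH by (simp add: ring_of_type_algebra_inv)
    next
      case (eng_add h1 h2)
      then show ?case using add by (simp add: ring_of_type_algebra_def)
    next
      case (eng_mult h1 h2)
      then show ?case using mult by (simp add: ring_of_type_algebra_def)
    qed
  qed
qed

section \<open>The degree of a simple extension\<close>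

text \<open>The powers of \<open>x\<close> with exponent below \<open>degree m\<close> form a basis:
  they span by division with remainder by \<open>m\<close>, and they are independent because no
  nonzero polynomial of smaller degree annihilates \<open>x\<close>.\<close>

lemma ext_degree_minimal_polynomial:
  fixes x :: "'k::field alg_closure"
  assumes m: "m \<noteq> 0" "ac_eval m x = 0"
    and min: "\<And>f. f \<noteq> 0 \<Longrightarrow> ac_eval f x = 0 \<Longrightarrow> degree m \<le> degree f"
  shows "ext_degree x = degree m"
    and "adjoin x = (\<lambda>f. ac_eval f x) ` {f. degree f < degree m}"
proof -
  interpret V: vector_space "\<lambda>(c::'k) y. to_ac c * y"
    by unfold_locales (simp_all add: algebra_simps)
  have pos: "degree m > 0"
  proof (rule ccontr)
    assume "\<not> degree m > 0"
    then obtain c where "m = [:c:]" using degree_eq_zeroE by blast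
    then show False using m by (simp add: ac_eval_pCons)
  qed
  have lt: "degree f < degree m \<Longrightarrow> ac_eval f x = 0 \<Longrightarrow> f = 0" for f
    using min[of f] by force
  show *: "adjoin x = (\<lambda>f. ac_eval f x) ` {f. degree f < degree m}"
  proof -
    have "ac_eval f x \<in> (\<lambda>f. ac_eval f x) ` {f. degree f < degree m}" for f
    proof (rule image_eqI)
      have "ac_eval f x = ac_eval (f div m * m + f mod m) x" by simp
      also have "\<dots> = ac_eval (f mod m) x"
        unfolding ac_eval_add ac_eval_mult using m by simp
      finally show "ac_eval f x = ac_eval (f mod m) x" .
      show "f mod m \<in> {f. degree f < degree m}"
        using degree_mod_less'[of m f] m pos by (cases "f mod m = 0") auto
    qed
    then show ?thesis unfolding adjoin_eq_range_ac_eval by blast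
  qed
  define B where "B = (\<lambda>i. x ^ i) ` {..<degree m}"
  \<comment> \<open>\<open>B\<close> is a set, so coincident powers must be excluded before counting
    it; a coincidence would make a difference of two monomials annihilate \<open>x\<close>.\<close>
  have inj: "inj_on (\<lambda>i. x ^ i) {..<degree m}"
  proof (rule inj_onI)
    fix i j assume ij: "i \<in> {..<degree m}" "j \<in> {..<degree m}" "x ^ i = x ^ j"
    let ?f = "monom 1 i - monom 1 j :: 'k poly"
    have "degree ?f < degree m"
      using ij degree_diff_le_max[of "monom (1::'k) i" "monom 1 j"]
      by (simp add: degree_monom_eq)
    moreover have "ac_eval ?f x = 0"
    proof -
      have "map_poly to_ac ?f = monom 1 i - monom 1 j"
        by (rule poly_eqI) (simp add: coeff_map_poly)
      then show ?thesis using ij by (simp add: ac_eval_def poly_monom)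
    qed
    ultimately have "?f = 0" by (rule lt)
    then show "i = j" by (metis coeff_monom eq_iff_diff_eq_0 one_neq_zero)
  qed
  have indep: "V.independent B"
  proof
    assume "V.dependent B"
    then obtain u where u: "\<exists>y\<in>B. u y \<noteq> 0" "(\<Sum>y\<in>B. to_ac (u y) * y) = 0"
      by (subst (asm) V.dependent_finite) (auto simp: B_def)
    \<comment> \<open>The coefficients \<open>u\<close> are indexed by elements of \<open>B\<close>;
      \<open>f\<close> collects them into a polynomial vanishing at \<open>x\<close>.\<close>
    define f where "f = (\<Sum>i<degree m. monom (u (x ^ i)) i)"
    have coeff: "coeff f i = (if i < degree m then u (x ^ i) else 0)" for i
      by (auto simp: f_def coeff_sum if_distrib cong: if_cong)
    have deg: "degree f < degree m"
      using pos by (intro degree_lessI) (auto simp: coeff)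
    have "ac_eval f x = (\<Sum>i<degree m. to_ac (u (x ^ i)) * x ^ i)"
      by (simp add: ac_eval_altdef[OF deg] coeff)
    also have "\<dots> = 0"
      using u(2) by (simp add: B_def sum.reindex[OF inj])
    finally have "f = 0" using lt deg by blast
    with u(1) coeff show False by (auto simp: B_def) (metis coeff_0)
  qed
  have "V.dim (adjoin x) = degree m"
  proof (rule V.dim_unique)
    show "B \<subseteq> adjoin x"
    proof -
      have "x ^ i \<in> adjoin x" for i
        using ac_eval_in_adjoin[of "monom 1 i" x]
        by (simp add: ac_eval_def map_poly_monom poly_monom)
      then show ?thesis by (auto simp: B_def)
    qed
    show "adjoin x \<subseteq> V.span B"
    proof
      fix y assume "y \<in> adjoin x"
      then obtain f where f: "y = ac_eval f x" "degree f < degree m" using * by auto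
      have "(\<Sum>i<degree m. to_ac (coeff f i) * x ^ i) \<in> V.span B"
        by (intro V.span_sum V.span_scale V.span_base) (auto simp: B_def)
      then show "y \<in> V.span B" using f ac_eval_altdef by metis
    qed
    show "V.independent B" by (rule indep)
    show "card B = degree m" by (simp add: B_def card_image inj)
  qed
  then show "ext_degree x = degree m" by (simp add: ext_degree_def)
qed

text \<open>Annihilating polynomials have at least the degree of the minimal one. This will bound
  the degrees of all roots of a polynomial over the base field.\<close>

lemma ext_degree_le_degree:
  assumes "f \<noteq> 0" "ac_eval f x = 0"
  shows "ext_degree x \<le> degree f"
  using exists_minimal_polynomial[of x] ext_degree_minimal_polynomial(1) assms by metis

lemma adjoin_eq_low_degree:
  "adjoin x = (\<lambda>f. ac_eval f x) ` {f. degree f < ext_degree x}"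
proof -
  obtain m where "m \<noteq> 0" "ac_eval m x = 0"
    "\<And>f. f \<noteq> 0 \<Longrightarrow> ac_eval f x = 0 \<Longrightarrow> degree m \<le> degree f"
    using exists_minimal_polynomial[of x] by blast
  from ext_degree_minimal_polynomial[OF this] show ?thesis by simp
qed

section \<open>Valuations\<close>

text \<open>The instances are \<open>v\<close> on the algebraic closure and \<open>w\<close> on
  \<open>base_ratfuns\<close>. Of the latter only products, powers and inverses are formed, hence
  the multiplicative closure conditions.\<close>

locale valued_field =
  fixes F :: "'a::field set" and v :: "'a \<Rightarrow> rat"
  assumes valuation: "valuation_on F v"
    and one_closed: "1 \<in> F"
    and mult_closed: "x \<in> F \<Longrightarrow> y \<in> F \<Longrightarrow> x * y \<in> F"
    and inverse_closed: "x \<in> F \<Longrightarrow> inverse x \<in> F"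
begin

lemma v_mult: "x \<in> F \<Longrightarrow> y \<in> F \<Longrightarrow> x \<noteq> 0 \<Longrightarrow> y \<noteq> 0 \<Longrightarrow> v (x * y) = v x + v y"
  using valuation by (auto simp: valuation_on_def)

lemma v_one: "v 1 = 0"
  using v_mult[of 1 1] one_closed by simp

lemma power_closed: "x \<in> F \<Longrightarrow> x ^ n \<in> F"
  by (induction n) (auto intro: one_closed mult_closed)

lemma v_inverse: "x \<in> F \<Longrightarrow> x \<noteq> 0 \<Longrightarrow> v (inverse x) = - v x"
  using v_mult[of x "inverse x"] v_one inverse_closed by simp

lemma v_power: "x \<in> F \<Longrightarrow> x \<noteq> 0 \<Longrightarrow> v (x ^ n) = of_nat n * v x"
  by (induction n) (auto simp: v_one v_mult power_closed algebra_simps)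

end

locale valued_field_UNIV = valued_field UNIV v for v :: "'a::field \<Rightarrow> rat"
begin

text \<open>\<open>v 0\<close> is an arbitrary rational, so 0 is included by hand.\<close>

definition max_ideal :: "'a set" where
  "max_ideal = {x. x = 0 \<or> 0 < v x}"

text \<open>Twice \<open>v (-1)\<close> is \<open>v 1 = 0\<close>, and the rationals have no
  torsion.\<close>

lemma v_minus: "v (- x) = v x"
proof (cases "x = 0")
  case False
  have "v (-1) = 0"
    using v_mult[of "-1" "-1"] v_one by simp
  then show ?thesis using v_mult[of "-1" x] False by simp
qed simp

lemma v_add: "x \<noteq> 0 \<Longrightarrow> y \<noteq> 0 \<Longrightarrow> x + y \<noteq> 0 \<Longrightarrow> min (v x) (v y) \<le> v (x + y)"
  using valuation by (auto simp: valuation_on_def)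

lemma v_divide: "x \<noteq> 0 \<Longrightarrow> y \<noteq> 0 \<Longrightarrow> v (x / y) = v x - v y"
  by (simp add: divide_inverse v_mult v_inverse)

lemma max_ideal_0: "0 \<in> max_ideal"
  by (simp add: max_ideal_def)

lemma max_ideal_add: "x \<in> max_ideal \<Longrightarrow> y \<in> max_ideal \<Longrightarrow> x + y \<in> max_ideal"
  using v_add[of x y] by (cases "x = 0"; cases "y = 0"; cases "x + y = 0") (auto simp: max_ideal_def)

lemma max_ideal_minus: "x \<in> max_ideal \<Longrightarrow> - x \<in> max_ideal"
  by (auto simp: max_ideal_def v_minus)

lemma max_ideal_mult:
  "x \<in> max_ideal \<Longrightarrow> y = 0 \<or> 0 \<le> v y \<Longrightarrow> y * x \<in> max_ideal"
  by (cases "x = 0"; cases "y = 0") (auto simp: max_ideal_def v_mult)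

section \<open>One-units\<close>

lemma one_unit_nonzero: "u - 1 \<in> max_ideal \<Longrightarrow> u \<noteq> 0"
  using v_minus[of 1] v_one by (auto simp: max_ideal_def)

lemma v_one_unit:
  assumes "u - 1 \<in> max_ideal"
  shows "v u = 0"
proof (cases "u = 1")
  case False
  note u0 = one_unit_nonzero[OF assms]
  have pos: "v (u - 1) > 0" using assms False by (auto simp: max_ideal_def)
  have "v u \<ge> 0" using v_add[of "u - 1" 1] False pos u0 v_one by simp
  \<comment> \<open>Here 1 is the sum of \<open>u\<close> and \<open>1 - u\<close>, and the second
    summand has positive valuation, so the minimum can only be bounded by \<open>v 1 = 0\<close>
    through \<open>u\<close>.\<close>
  moreover have "v u \<le> 0"
    using v_add[of u "1 - u"] False pos u0 v_one v_minus[of "u - 1"] by simp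
  ultimately show ?thesis by simp
qed (simp add: v_one)

lemma one_unit_mult:
  assumes "t - 1 \<in> max_ideal" "u - 1 \<in> max_ideal"
  shows "t * u - 1 \<in> max_ideal"
proof -
  have "t * (u - 1) + (t - 1) \<in> max_ideal"
    using assms by (intro max_ideal_add max_ideal_mult) (auto simp: v_one_unit)
  then show ?thesis by (simp add: algebra_simps)
qed

lemma one_unit_inverse:
  assumes "u - 1 \<in> max_ideal"
  shows "inverse u - 1 \<in> max_ideal"
proof -
  note u0 = one_unit_nonzero[OF assms]
  have "inverse u * (- (u - 1)) \<in> max_ideal"
    using assms u0 by (intro max_ideal_minus max_ideal_mult) (auto simp: v_one_unit v_inverse)
  also have "inverse u * (- (u - 1)) = inverse u - 1"
    using u0 by (simp add: algebra_simps)
  finally show ?thesis .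
qed

end


section \<open>Values of rational functions\<close>

lemma has_value_Fract: "poly b x \<noteq> 0 \<Longrightarrow> has_value (Fract a b) x (poly a x / poly b x)"
  by (auto simp: has_value_def)

text \<open>\<open>has_value\<close> admits any representing fraction without a pole at
  \<open>x\<close>; cross-multiplying two of them and evaluating gives equal quotients.\<close>

lemma has_value_unique:
  assumes "has_value \<phi> x y" "has_value \<phi> x z"
  shows "y = z"
proof -
  obtain a b a' b' where *: "\<phi> = Fract a b" "poly b x \<noteq> 0" "y = poly a x / poly b x"
    "\<phi> = Fract a' b'" "poly b' x \<noteq> 0" "z = poly a' x / poly b' x"
    using assms unfolding has_value_def by metis
  then have "a * b' = a' * b"
    by (metis eq_fract(1) poly_0)
  then have "poly a x * poly b' x = poly a' x * poly b x"
    by (metis poly_mult)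
  with * show ?thesis by (simp add: frac_eq_eq)
qed

lemma has_value_const: "has_value (ratfun_const c) x c"
  using has_value_Fract[of 1 x "[:c:]"] by (simp add: ratfun_const_def)

lemma has_value_one: "has_value 1 x 1"
  using has_value_Fract[of 1 x 1] by (simp add: One_fract_def)

lemma has_value_mult:
  assumes "has_value \<phi> x y" "has_value \<psi> x z"
  shows "has_value (\<phi> * \<psi>) x (y * z)"
proof -
  obtain a b a' b' where "\<phi> = Fract a b" "poly b x \<noteq> 0" "y = poly a x / poly b x"
    "\<psi> = Fract a' b'" "poly b' x \<noteq> 0" "z = poly a' x / poly b' x"
    using assms unfolding has_value_def by metis
  then show ?thesis using has_value_Fract[of "b * b'" x "a * a'"] by simp
qed

lemma has_value_add:
  assumes "has_value \<phi> x y" "has_value \<psi> x z"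
  shows "has_value (\<phi> + \<psi>) x (y + z)"
proof -
  obtain a b a' b' where *: "\<phi> = Fract a b" "poly b x \<noteq> 0" "y = poly a x / poly b x"
    "\<psi> = Fract a' b'" "poly b' x \<noteq> 0" "z = poly a' x / poly b' x"
    using assms unfolding has_value_def by metis
  then have "b \<noteq> 0" "b' \<noteq> 0" by auto
  with * show ?thesis
    using has_value_Fract[of "b * b'" x "a * b' + a' * b"] by (simp add: add_frac_eq)
qed

lemma has_value_minus: "has_value \<phi> x y \<Longrightarrow> has_value (- \<phi>) x (- y)"
  unfolding has_value_def by (metis minus_divide_left minus_fract poly_minus)

lemma has_value_diff:
  "has_value \<phi> x y \<Longrightarrow> has_value \<psi> x z \<Longrightarrow> has_value (\<phi> - \<psi>) x (y - z)"
  using has_value_add[OF _ has_value_minus] by fastforce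

lemma has_value_inverse:
  assumes "has_value \<phi> x y" "y \<noteq> 0"
  shows "has_value (inverse \<phi>) x (inverse y)"
  using assms unfolding has_value_def
  by (metis divide_eq_0_iff inverse_divide inverse_fract)

lemma has_value_power: "has_value \<phi> x y \<Longrightarrow> has_value (\<phi> ^ n) x (y ^ n)"
  by (induction n) (auto intro: has_value_one has_value_mult)

section \<open>Rational functions over the base field\<close>

lemma base_ratfuns_const: "ratfun_const (to_ac c) \<in> base_ratfuns"
  unfolding base_ratfuns_def ratfun_const_def
  by (rule CollectI, rule exI[of _ "[:c:]"], rule exI[of _ 1]) (simp add: map_poly_pCons)

lemma base_ratfuns_mult:
  assumes "\<phi> \<in> base_ratfuns" "\<psi> \<in> base_ratfuns"
  shows "\<phi> * \<psi> \<in> base_ratfuns"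
proof -
  obtain a b a' b' where "b \<noteq> 0" "b' \<noteq> 0"
    "\<phi> = Fract (map_poly to_ac a) (map_poly to_ac b)"
    "\<psi> = Fract (map_poly to_ac a') (map_poly to_ac b')"
    using assms unfolding base_ratfuns_def by blast
  then have "b * b' \<noteq> 0"
    "\<phi> * \<psi> = Fract (map_poly to_ac (a * a')) (map_poly to_ac (b * b'))"
    by (simp_all add: map_poly_to_ac_mult)
  then show ?thesis unfolding base_ratfuns_def by blast
qed

lemma base_ratfuns_inverse:
  assumes "\<phi> \<in> base_ratfuns"
  shows "inverse \<phi> \<in> base_ratfuns"
proof -
  obtain a b where *: "b \<noteq> 0" "\<phi> = Fract (map_poly to_ac a) (map_poly to_ac b)"
    using assms unfolding base_ratfuns_def by blast
  show ?thesis
  proof (cases "a = 0")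
    case True
    \<comment> \<open>Here \<open>\<phi>\<close> is 0, whose inverse is 0 by convention.\<close>
    then have "inverse \<phi> = \<phi>" using * by (simp add: fract_collapse)
    then show ?thesis using assms by simp
  next
    case False
    then show ?thesis using * unfolding base_ratfuns_def by auto
  qed
qed

lemma valued_field_base_ratfuns:
  "valuation_on base_ratfuns w \<Longrightarrow> valued_field base_ratfuns w"
  using base_ratfuns_const[of 1]
  by unfold_locales
    (auto simp: ratfun_const_def One_fract_def one_pCons intro: base_ratfuns_mult base_ratfuns_inverse)

lemma seq_ring_eq_contraction: "seq_ring v s = base_ratfuns \<inter> seq_ring_closure v s"
  by (auto simp: seq_ring_def seq_ring_closure_def)


section \<open>Stacked sequences\<close>

locale stacked_sequence = valued_field_UNIV v
  for v :: "'k::field alg_closure \<Rightarrow> rat" +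
  fixes s :: "nat \<Rightarrow> 'k alg_closure"
  assumes stacked: "stacked v s"
begin

section \<open>Growth of the degrees and distances between terms\<close>

lemma ext_degree_Suc: "ext_degree (s n) < ext_degree (s (Suc n))"
  using stacked by (simp add: stacked_def)

lemma ext_degree_less: "n < m \<Longrightarrow> ext_degree (s n) < ext_degree (s m)"
  using lift_Suc_mono_less[where f = "\<lambda>n. ext_degree (s n)", OF ext_degree_Suc] .

text \<open>The degrees are strictly increasing naturals, so they satisfy
  \<open>n \<le> ext_degree (s n)\<close> and are unbounded.\<close>

lemma less_ext_degree_eventually: "eventually (\<lambda>n. d < ext_degree (s n)) sequentially"
proof -
  have "n \<le> ext_degree (s n)" for n
  proof (induction n)
    case (Suc n)
    then show ?case using ext_degree_Suc[of n] by linarith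
  qed simp
  then have "d < ext_degree (s n)" if "Suc d \<le> n" for n
    using that by (meson Suc_le_lessD le_trans)
  then show ?thesis
    unfolding eventually_sequentially by blast
qed

text \<open>The definition compares consecutive terms only. Later steps have larger valuation than
  \<open>s m - s n\<close>, so by the ultrametric inequality they cannot bring the valuation of the
  difference down.\<close>

lemma stacked_gap:
  assumes "n < m" "ext_degree c < ext_degree (s n)"
  shows "v (s n - c) < v (s m - s n)"
  using assms(1)
proof (induction m)
  case (Suc m)
  show ?case
  proof (cases "m = n")
    case True
    then show ?thesis using stacked assms(2) by (simp add: stacked_def)
  next
    case False
    with Suc have nm: "n < m" by simp
    \<comment> \<open>Stacking at index \<open>m\<close> with \<open>c = s n\<close>, which has
      smaller degree than \<open>s m\<close>.\<close>
    have gap: "v (s m - s n) < v (s (Suc m) - s m)"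
      using stacked ext_degree_less[OF nm] by (simp add: stacked_def)
    have ne: "s m - s n \<noteq> 0" "s (Suc m) - s m \<noteq> 0" "s (Suc m) - s n \<noteq> 0"
      using ext_degree_less[OF nm] ext_degree_less[of m "Suc m"] ext_degree_less[of n "Suc m"] nm
      by auto
    have "s (Suc m) - s m + (s m - s n) = s (Suc m) - s n" by simp
    then have "v (s m - s n) \<le> v (s (Suc m) - s n)"
      using v_add[OF ne(2,1)] ne(3) gap by simp
    then show ?thesis using Suc.IH[OF nm] by simp
  qed
qed simp

section \<open>Polynomials whose roots have low degree\<close>

text \<open>By \<open>stacked_gap\<close> every such root is strictly farther from
  \<open>s n\<close> than all later terms are.\<close>

definition low_roots :: "'k alg_closure poly \<Rightarrow> nat \<Rightarrow> bool" where
  "low_roots f n \<longleftrightarrow> f \<noteq> 0 \<and> (\<forall>c. poly f c = 0 \<longrightarrow> ext_degree c < ext_degree (s n))"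

lemma low_roots_mono: "low_roots f n \<Longrightarrow> n \<le> m \<Longrightarrow> low_roots f m"
  using ext_degree_less[of n m] by (cases "n = m") (force simp: low_roots_def)+

lemma low_roots_nonzero: "low_roots f n \<Longrightarrow> poly f (s n) \<noteq> 0"
  by (auto simp: low_roots_def)

text \<open>There are finitely many roots, and the degrees of the terms are unbounded.\<close>

lemma eventually_low_roots:
  assumes "f \<noteq> 0"
  shows "eventually (low_roots f) sequentially"
proof -
  have "finite {c. poly f c = 0}" using assms by (rule poly_roots_finite)
  then have "eventually (\<lambda>n. \<forall>c\<in>{c. poly f c = 0}. ext_degree c < ext_degree (s n)) sequentially"
    by (rule eventually_ball_finite) (auto intro: less_ext_degree_eventually)
  then show ?thesis
    by eventually_elim (use assms in \<open>auto simp: low_roots_def\<close>)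
qed

text \<open>
  For a linear factor this is the stacking condition, since
  \<open>(s m - c) / (s n - c) - 1 = (s m - s n) / (s n - c)\<close>.
\<close>

lemma low_roots_one_unit:
  assumes "low_roots f n" "n \<le> m"
  shows "poly f (s m) / poly f (s n) - 1 \<in> max_ideal"
  using assms(1)
proof (induction "degree f" arbitrary: f)
  case 0
  then obtain c where "f = [:c:]" using degree_eq_zeroE by metis
  moreover have "c \<noteq> 0" using 0 calculation by (auto simp: low_roots_def)
  ultimately show ?case by (simp add: max_ideal_0)
next
  case (Suc d)
  then obtain c where c: "poly f c = 0"
    using alg_closed_imp_poly_has_root[of f] by auto
  \<comment> \<open>Both factors yield one-units: \<open>g\<close> by induction, as its roots are
    roots of \<open>f\<close>, and the linear factor by stacking.\<close>
  then obtain g where f: "f = [:- c, 1:] * g"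
    using poly_eq_0_iff_dvd by blast
  have cn: "ext_degree c < ext_degree (s n)"
    using Suc.prems c by (simp add: low_roots_def)
  have g: "low_roots g n" using Suc.prems by (auto simp: low_roots_def f)
  then have "g \<noteq> 0" by (simp add: low_roots_def)
  then have "d = degree g" using Suc.hyps(2) by (simp add: f degree_mult_eq del: mult_pCons_left)
  then have *: "poly g (s m) / poly g (s n) - 1 \<in> max_ideal"
    using Suc.hyps(1) g by blast
  have "s n \<noteq> c" using cn by auto
  have "(s m - c) / (s n - c) - 1 = (s m - s n) / (s n - c)"
    using \<open>s n \<noteq> c\<close> by (simp add: field_simps)
  also have "\<dots> \<in> max_ideal"
  \<comment> \<open>The case of equality covers \<open>m = n\<close>, where the quotient is 0 and
    \<open>v\<close> says nothing.\<close>
  proof (cases "s m = s n")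
    case False
    then have "n < m" using assms(2) by (cases "n = m") auto
    then show ?thesis
      using stacked_gap[OF _ cn, of m] False \<open>s n \<noteq> c\<close> by (simp add: max_ideal_def v_divide)
  qed (simp add: max_ideal_0)
  finally have "(s m - c) / (s n - c) - 1 \<in> max_ideal" .
  from one_unit_mult[OF this *] show ?case
    by (simp add: f algebra_simps)
qed

section \<open>Rational functions with constant valuation along the sequence\<close>

text \<open>Some representing fraction has to qualify, reduced or not. From index \<open>n\<close>
  on, values then change only by one-units.\<close>

definition index_stable :: "'k alg_closure poly fract \<Rightarrow> nat \<Rightarrow> bool" where
  "index_stable \<phi> n \<longleftrightarrow> (\<exists>a b. \<phi> = Fract a b \<and> low_roots a n \<and> low_roots b n)"

text \<open>The quotient of the values at \<open>s m\<close> and \<open>s n\<close> is the one-unit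
  of the numerator times the inverse of that of the denominator.\<close>

lemma index_stable_value:
  assumes "index_stable \<phi> n"
  obtains x where "has_value \<phi> (s n) x" "x \<noteq> 0"
    "\<And>m. n \<le> m \<Longrightarrow> \<exists>y. has_value \<phi> (s m) y \<and> y \<noteq> 0 \<and> v y = v x \<and> y / x - 1 \<in> max_ideal"
proof -
  obtain a b where ab: "\<phi> = Fract a b" "low_roots a n" "low_roots b n"
    using assms unfolding index_stable_def by blast
  let ?x = "poly a (s n) / poly b (s n)"
  have x: "has_value \<phi> (s n) ?x" "?x \<noteq> 0"
    using ab low_roots_nonzero by (auto intro: has_value_Fract)
  have "\<exists>y. has_value \<phi> (s m) y \<and> y \<noteq> 0 \<and> v y = v ?x \<and> y / ?x - 1 \<in> max_ideal" if "n \<le> m" for m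
  proof (intro exI conjI)
    let ?y = "poly a (s m) / poly b (s m)"
    have nz: "poly a (s m) \<noteq> 0" "poly b (s m) \<noteq> 0"
      using ab that low_roots_nonzero low_roots_mono by blast+
    then show "has_value \<phi> (s m) ?y" "?y \<noteq> 0"
      using ab by (auto intro: has_value_Fract)
    have "(poly a (s m) / poly a (s n)) * inverse (poly b (s m) / poly b (s n)) - 1 \<in> max_ideal"
      using ab that by (intro one_unit_mult one_unit_inverse low_roots_one_unit)
    then show *: "?y / ?x - 1 \<in> max_ideal"
      by (simp add: field_simps)
    show "v ?y = v ?x"
      using v_one_unit[OF *] v_divide[OF \<open>?y \<noteq> 0\<close> x(2)] by simp
  qed
  with x that show ?thesis by blast
qed

lemma eventually_index_stable:
  assumes "\<phi> \<noteq> 0"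
  shows "eventually (index_stable \<phi>) sequentially"
proof -
  obtain a b where ab: "\<phi> = Fract a b" "b \<noteq> 0" by (cases \<phi>)
  with assms have "a \<noteq> 0" by (auto simp: fract_collapse)
  show ?thesis
    using eventually_low_roots[OF \<open>a \<noteq> 0\<close>] eventually_low_roots[OF \<open>b \<noteq> 0\<close>]
    by eventually_elim (use ab in \<open>auto simp: index_stable_def\<close>)
qed

text \<open>A polynomial over the base field has no roots of degree exceeding its own.\<close>

lemma adjoin_value_index_stable:
  assumes "y \<in> adjoin (s n)" "y \<noteq> 0"
  obtains \<phi> where "\<phi> \<in> base_ratfuns" "\<phi> \<noteq> 0" "index_stable \<phi> n" "has_value \<phi> (s n) y"
proof -
  \<comment> \<open>The representative of small degree is chosen so that its roots have degree below
    that of \<open>s n\<close>.\<close>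
  obtain g where g: "y = ac_eval g (s n)" "degree g < ext_degree (s n)"
    using assms adjoin_eq_low_degree by blast
  have "g \<noteq> 0" using g assms by auto
  have "low_roots (map_poly to_ac g) n"
    using \<open>g \<noteq> 0\<close> ext_degree_le_degree[OF \<open>g \<noteq> 0\<close>] g(2)
    by (force simp: low_roots_def ac_eval_def)
  moreover have "low_roots 1 n" by (simp add: low_roots_def)
  ultimately have stable: "index_stable (Fract (map_poly to_ac g) 1) n"
    by (auto simp: index_stable_def)
  have "has_value (Fract (map_poly to_ac g) 1) (s n) y"
    using has_value_Fract[of 1 "s n" "map_poly to_ac g"] g by (simp add: ac_eval_def)
  moreover have "Fract (map_poly to_ac g) 1 \<in> base_ratfuns"
    unfolding base_ratfuns_def by (rule CollectI, rule exI[of _ g], rule exI[of _ 1]) simp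
  moreover have "Fract (map_poly to_ac g) 1 \<noteq> 0"
    using \<open>g \<noteq> 0\<close> by (simp add: Zero_fract_def eq_fract)
  ultimately show ?thesis using that stable by blast
qed

lemma eventually_value_in_adjoin:
  assumes "\<phi> \<in> base_ratfuns"
  shows "eventually (\<lambda>n. \<exists>y\<in>adjoin (s n). has_value \<phi> (s n) y) sequentially"
proof -
  obtain a b where ab: "b \<noteq> 0" "\<phi> = Fract (map_poly to_ac a) (map_poly to_ac b)"
    using assms unfolding base_ratfuns_def by blast
  \<comment> \<open>This keeps the denominator from vanishing at \<open>s n\<close>.\<close>
  have "eventually (low_roots (map_poly to_ac b)) sequentially"
    using ab by (intro eventually_low_roots) simp
  then show ?thesis
  proof eventually_elim
    case (elim n)
    have "ac_eval a (s n) * inverse (ac_eval b (s n)) \<in> adjoin (s n)"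
      by (intro adjoin_mult adjoin_inverse ac_eval_in_adjoin)
    moreover have "has_value \<phi> (s n) (ac_eval a (s n) * inverse (ac_eval b (s n)))"
      using has_value_Fract[OF low_roots_nonzero[OF elim], of "map_poly to_ac a"] ab
      by (simp add: ac_eval_def divide_inverse)
    ultimately show ?case by blast
  qed
qed

text \<open>All values from index \<open>n\<close> on have valuation \<open>v x\<close>, so
  conditions on the eventual valuations are decided at \<open>s n\<close>.\<close>

lemma index_stable_mem_iff:
  assumes "index_stable \<phi> n" "has_value \<phi> (s n) x"
  shows "\<phi> \<in> seq_ring_closure v s \<longleftrightarrow> 0 \<le> v x"
    and "x \<noteq> 0"
    and "(\<forall>\<^sub>F m in sequentially. \<exists>y\<in>max_ideal. has_value \<phi> (s m) y) \<longleftrightarrow> 0 < v x"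
proof -
  obtain x' where "has_value \<phi> (s n) x'" "x' \<noteq> 0" and
    "\<And>m. n \<le> m \<Longrightarrow> \<exists>y. has_value \<phi> (s m) y \<and> y \<noteq> 0 \<and> v y = v x' \<and> y / x' - 1 \<in> max_ideal"
    using index_stable_value[OF assms(1)] by metis
  then have "x \<noteq> 0" and
    val: "\<And>m. n \<le> m \<Longrightarrow> \<exists>y. has_value \<phi> (s m) y \<and> y \<noteq> 0 \<and> v y = v x"
    using has_value_unique[OF assms(2)] by blast+
  then show "x \<noteq> 0" by simp
  \<comment> \<open>On nonzero values \<open>P\<close> depends on the valuation only; this treats
    the valuation ring and its maximal ideal together.\<close>
  have *: "(\<forall>\<^sub>F m in sequentially. \<exists>y. P y \<and> has_value \<phi> (s m) y) \<longleftrightarrow> Q (v x)"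
    if PQ: "\<And>y. y \<noteq> 0 \<Longrightarrow> P y \<longleftrightarrow> Q (v y)" for P Q
  proof
    assume "\<forall>\<^sub>F m in sequentially. \<exists>y. P y \<and> has_value \<phi> (s m) y"
    then obtain N where "\<And>m. N \<le> m \<Longrightarrow> \<exists>y. P y \<and> has_value \<phi> (s m) y"
      unfolding eventually_sequentially by blast
    then obtain y where "P y" "has_value \<phi> (s (max n N)) y" by (meson max.cobounded2)
    moreover obtain y' where "has_value \<phi> (s (max n N)) y'" "y' \<noteq> 0" "v y' = v x"
      using val by (meson max.cobounded1)
    ultimately show "Q (v x)" using PQ has_value_unique by metis
  next
    assume "Q (v x)"
    then show "\<forall>\<^sub>F m in sequentially. \<exists>y. P y \<and> has_value \<phi> (s m) y"
      unfolding eventually_sequentially using val PQ by metis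
  qed
  show "\<phi> \<in> seq_ring_closure v s \<longleftrightarrow> 0 \<le> v x"
    using *[of "\<lambda>y. y \<in> valuation_ring UNIV v" "\<lambda>z. 0 \<le> z"]
    by (simp add: seq_ring_closure_def valuation_ring_def Bex_def)
  show "(\<forall>\<^sub>F m in sequentially. \<exists>y\<in>max_ideal. has_value \<phi> (s m) y) \<longleftrightarrow> 0 < v x"
    using *[of "\<lambda>y. y \<in> max_ideal" "\<lambda>z. 0 < z"]
    by (simp add: max_ideal_def Bex_def)
qed

lemma index_stable_inverse:
  assumes "index_stable \<phi> n"
  shows "index_stable (inverse \<phi>) n"
  using assms unfolding index_stable_def by (metis inverse_fract)

lemma index_stable_power:
  assumes "index_stable \<phi> n"
  shows "index_stable (\<phi> ^ k) n"
proof (induction k)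
  case 0
  have "low_roots 1 n" by (simp add: low_roots_def)
  then show ?case by (auto simp: index_stable_def One_fract_def)
next
  case (Suc k)
  obtain a b a' b' where "\<phi> = Fract a b" "\<phi> ^ k = Fract a' b'"
    "low_roots a n" "low_roots b n" "low_roots a' n" "low_roots b' n"
    using assms Suc.IH unfolding index_stable_def by blast
  then have "\<phi> ^ Suc k = Fract (a * a') (b * b')" "low_roots (a * a') n" "low_roots (b * b') n"
    by (auto simp: low_roots_def)
  then show ?case unfolding index_stable_def by blast
qed

lemma index_stable_const_mult:
  assumes "index_stable \<phi> n" "c \<noteq> 0"
  shows "index_stable (ratfun_const c * \<phi>) n"
proof -
  obtain a b where "\<phi> = Fract a b" "low_roots a n" "low_roots b n"
    using assms unfolding index_stable_def by blast
  then have "ratfun_const c * \<phi> = Fract (smult c a) b" "low_roots (smult c a) n" "low_roots b n"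
    using assms(2) by (auto simp: low_roots_def ratfun_const_def)
  then show ?thesis unfolding index_stable_def by blast
qed

section \<open>The maximal ideal and the residue fields\<close>

text \<open>A nonzero \<open>\<phi>\<close> is stable at some \<open>n\<close>, with value
  \<open>x\<close> there. It lies in the ring iff \<open>0 \<le> v x\<close>, and its inverse does
  iff \<open>v x \<le> 0\<close>, so it is a nonunit iff \<open>0 < v x\<close>.\<close>

lemma nonunits_seq_ring_closure:
  "nonunits (seq_ring_closure v s) =
     {\<phi>. \<forall>\<^sub>F n in sequentially. \<exists>y\<in>max_ideal. has_value \<phi> (s n) y}" (is "_ = ?I")
proof -
  let ?V = "seq_ring_closure v s"
  have units: "Units (ring_on ?V) = {\<phi> \<in> ?V. \<phi> \<noteq> 0 \<and> inverse \<phi> \<in> ?V}"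
  proof -
    have "inverse x = y" if "x * y = 1" for x y :: "'k alg_closure poly fract"
      using that by (rule inverse_unique)
    then show ?thesis
      by (force simp: Units_def ring_on_def ring_of_type_algebra_def)
  qed
  have zero: "0 \<in> ?V" "0 \<in> ?I"
    using has_value_const[of "0 :: 'k alg_closure"]
    by (auto simp: seq_ring_closure_def valuation_ring_def max_ideal_def ratfun_const_def
        Zero_fract_def intro!: always_eventually)
  have "\<phi> \<in> nonunits ?V \<longleftrightarrow> \<phi> \<in> ?I" for \<phi>
  proof (cases "\<phi> = 0")
    case True
    then show ?thesis using zero by (simp add: nonunits_def units)
  next
    case False
    obtain n where n: "index_stable \<phi> n"
      using eventually_index_stable[OF False] eventually_sequentially by auto
    then obtain x where x: "has_value \<phi> (s n) x" by (meson index_stable_value)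
    have "x \<noteq> 0" by (rule index_stable_mem_iff(2)[OF n x])
    then have "inverse \<phi> \<in> ?V \<longleftrightarrow> v x \<le> 0"
      using index_stable_mem_iff(1)[OF index_stable_inverse[OF n] has_value_inverse[OF x]]
      by (simp add: v_inverse)
    then show ?thesis
      using index_stable_mem_iff[OF n x] False by (auto simp: nonunits_def units)
  qed
  then show ?thesis by blast
qed

text \<open>The nonunits are closed under sums and negation because values add and
  \<open>max_ideal\<close> has these closure properties.\<close>

lemma residue_eqI:
  assumes "\<phi> - \<psi> \<in> nonunits (seq_ring_closure v s)"
  shows "nonunits (seq_ring_closure v s) +>\<^bsub>ring_on (seq_ring_closure v s)\<^esub> \<phi> =
         nonunits (seq_ring_closure v s) +>\<^bsub>ring_on (seq_ring_closure v s)\<^esub> \<psi>"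
proof -
  define I where "I = nonunits (seq_ring_closure v s)"
  have add: "\<chi> + \<chi>' \<in> I" if "\<chi> \<in> I" "\<chi>' \<in> I" for \<chi> \<chi>'
    using that unfolding I_def nonunits_seq_ring_closure mem_Collect_eq
    by eventually_elim (blast intro: has_value_add max_ideal_add)
  have minus: "- \<chi> \<in> I" if "\<chi> \<in> I" for \<chi>
    using that unfolding I_def nonunits_seq_ring_closure mem_Collect_eq
    by eventually_elim (blast intro: has_value_minus max_ideal_minus)
  have coset: "I +>\<^bsub>ring_on V\<^esub> \<chi> = {h. h - \<chi> \<in> I}" for \<chi> V
  proof -
    have "h = (h - \<chi>) + \<chi>" for h by simp
    then show ?thesis
      by (auto simp: a_r_coset_def' ring_on_def ring_of_type_algebra_def)
  qed
  have "h - \<phi> \<in> I \<longleftrightarrow> h - \<psi> \<in> I" for h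
    using add[of "h - \<phi>" "\<phi> - \<psi>"] add[of "h - \<psi>" "- (\<phi> - \<psi>)"] minus[of "\<phi> - \<psi>"] assms
    by (auto simp: I_def)
  then show ?thesis unfolding I_def[symmetric] coset by simp
qed

text \<open>A later value \<open>y\<close> satisfies \<open>y - x = x * (y / x - 1)\<close>, which
  lies in \<open>max_ideal\<close> because \<open>x\<close> is integral.\<close>

lemma residue_eq_residue_value:
  assumes "index_stable \<phi> n" "has_value \<phi> (s n) x" "0 \<le> v x"
  shows "nonunits (seq_ring_closure v s) +>\<^bsub>ring_on (seq_ring_closure v s)\<^esub> \<phi> =
         nonunits (seq_ring_closure v s) +>\<^bsub>ring_on (seq_ring_closure v s)\<^esub> ratfun_const x"
proof (rule residue_eqI)
  obtain x' where "has_value \<phi> (s n) x'" and "x' \<noteq> 0" and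
    "\<And>m. n \<le> m \<Longrightarrow> \<exists>y. has_value \<phi> (s m) y \<and> y \<noteq> 0 \<and> v y = v x' \<and> y / x' - 1 \<in> max_ideal"
    using index_stable_value[OF assms(1)] by metis
  then have "x \<noteq> 0" and val: "\<And>m. n \<le> m \<Longrightarrow> \<exists>y. has_value \<phi> (s m) y \<and> y / x - 1 \<in> max_ideal"
    using has_value_unique[OF assms(2)] by blast+
  have "\<exists>y\<in>max_ideal. has_value (\<phi> - ratfun_const x) (s m) y" if nm: "n \<le> m" for m
  proof -
    obtain y where y: "has_value \<phi> (s m) y" "y / x - 1 \<in> max_ideal" using val[OF nm] by blast
    have "x * (y / x - 1) \<in> max_ideal" using y assms(3) by (intro max_ideal_mult) auto
    also have "x * (y / x - 1) = y - x" using \<open>x \<noteq> 0\<close> by (simp add: field_simps)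
    finally show ?thesis using has_value_diff[OF y(1) has_value_const] by blast
  qed
  then show "\<phi> - ratfun_const x \<in> nonunits (seq_ring_closure v s)"
    unfolding nonunits_seq_ring_closure eventually_sequentially by blast
qed

text \<open>A nonzero integral element of \<open>adjoin (s n)\<close> shares its residue with the
  function from \<open>adjoin_value_index_stable\<close>; a nonzero function in
  \<open>seq_ring\<close> shares it with its value at a late term. The zero function is stable at no
  index, hence the separate cases.\<close>

lemma residue_fields_eq: "(\<Union>n. residue_field_ext v s n) = residue_field_seq v s"
proof -
  define \<rho> where "\<rho> \<phi> = nonunits (seq_ring_closure v s) +>\<^bsub>ring_on (seq_ring_closure v s)\<^esub> \<phi>" for \<phi>
  have const0: "ratfun_const 0 = (0 :: 'k alg_closure poly fract)"
    by (simp add: ratfun_const_def Zero_fract_def)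
  have zero_closed: "0 \<in> seq_ring v s"
    using base_ratfuns_const[of "0 :: 'k"] has_value_const[of "0 :: 'k alg_closure"] const0
    by (auto simp: seq_ring_def valuation_ring_def intro!: always_eventually)
  have "\<rho> (ratfun_const y) \<in> \<rho> ` seq_ring v s" if y: "y \<in> valuation_ring (adjoin (s n)) v" for y n
  proof (cases "y = 0")
    case True
    then show ?thesis using zero_closed const0 by simp
  next
    case False
    with y have y': "y \<in> adjoin (s n)" "0 \<le> v y" by (auto simp: valuation_ring_def)
    obtain \<phi> where \<phi>: "\<phi> \<in> base_ratfuns" "index_stable \<phi> n" "has_value \<phi> (s n) y"
      using adjoin_value_index_stable[OF y'(1) False] by blast
    then have "\<phi> \<in> seq_ring v s" using y' index_stable_mem_iff(1) seq_ring_eq_contraction by blast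
    moreover have "\<rho> \<phi> = \<rho> (ratfun_const y)"
      unfolding \<rho>_def by (rule residue_eq_residue_value[OF \<phi>(2,3) y'(2)])
    ultimately show ?thesis by (metis image_eqI)
  qed
  moreover have "\<rho> \<phi> \<in> (\<Union>n. \<rho> ` ratfun_const ` valuation_ring (adjoin (s n)) v)"
    if \<phi>: "\<phi> \<in> seq_ring v s" for \<phi>
  proof (cases "\<phi> = 0")
    case True
    have "0 \<in> valuation_ring (adjoin (s 0)) v"
      using adjoin_base[of 0 "s 0"] by (simp add: valuation_ring_def)
    then show ?thesis using True const0 by (metis UN_I UNIV_I image_eqI)
  next
    case False
    have "\<phi> \<in> base_ratfuns" "\<phi> \<in> seq_ring_closure v s" using \<phi> seq_ring_eq_contraction by auto
    from eventually_conj[OF eventually_value_in_adjoin[OF this(1)] eventually_index_stable[OF False]]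
    obtain n y where n: "y \<in> adjoin (s n)" "has_value \<phi> (s n) y" "index_stable \<phi> n"
      unfolding eventually_sequentially by blast
    then have "0 \<le> v y" using index_stable_mem_iff(1) \<open>\<phi> \<in> seq_ring_closure v s\<close> by blast
    then have "\<rho> \<phi> = \<rho> (ratfun_const y)" "y \<in> valuation_ring (adjoin (s n)) v"
      using n residue_eq_residue_value by (auto simp: \<rho>_def valuation_ring_def)
    then show ?thesis by blast
  qed
  ultimately show ?thesis
    unfolding residue_field_ext_def residue_field_seq_def residue_image_def \<rho>_def[symmetric]
    by blast
qed

section \<open>Comparison of the value groups\<close>

text \<open>
  Both valuations take rational values, so it suffices to compare them on the products of a power
  of \<open>\<phi>\<close> with a power of the base element \<open>\<pi>\<close>, and there only the common ring matters.
\<close>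

lemma seq_valuation_eq:
  assumes w: "valuation_on base_ratfuns w"
    and ring: "valuation_ring base_ratfuns w = seq_ring v s"
    and \<pi>: "\<pi> \<noteq> 0" "v (to_ac \<pi>) = 1" "w (ratfun_const (to_ac \<pi>)) = 1"
    and \<phi>: "\<phi> \<in> base_ratfuns" "\<phi> \<noteq> 0" "index_stable \<phi> n" "has_value \<phi> (s n) x"
  shows "w \<phi> = v x"
proof -
  interpret W: valued_field base_ratfuns w
    using w by (rule valued_field_base_ratfuns)
  define P where "P = ratfun_const (to_ac \<pi>)"
  have P: "P \<in> base_ratfuns" "P \<noteq> 0" "has_value P (s n) (to_ac \<pi>)"
    using base_ratfuns_const has_value_const \<pi>(1)
    by (auto simp: P_def ratfun_const_def Zero_fract_def eq_fract)
  have x: "x \<noteq> 0" using index_stable_mem_iff(2) \<phi> by blast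
  obtain r q :: int where rq: "q > 0" "v x = of_int r / of_int q"
    by (cases "v x") (auto simp: Fract_of_int_quotient)
  \<comment> \<open>\<open>c\<close> is \<open>\<pi>\<close> to the power \<open>-r\<close>; the
    sign of \<open>r\<close> decides between a power and its inverse.\<close>
  obtain c where c: "c \<noteq> 0" "v (to_ac c) = - of_int r" "w (ratfun_const (to_ac c)) = - of_int r"
  proof
    have const_mult: "ratfun_const (y * z) = ratfun_const y * ratfun_const z"
      for y z :: "'k alg_closure"
      by (simp add: ratfun_const_def mult.commute)
    have const_power: "ratfun_const (to_ac \<pi> ^ k) = P ^ k" for k
    proof (induction k)
      case 0
      show ?case by (simp add: ratfun_const_def One_fract_def one_pCons)
    qed (simp add: const_mult P_def)
    have const_inverse: "ratfun_const (inverse y) = inverse (ratfun_const y)"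
      if "y \<noteq> 0" for y :: "'k alg_closure"
      using that by (simp add: ratfun_const_def eq_fract one_pCons)
    let ?k = "nat \<bar>r\<bar>"
    let ?c = "if r \<le> 0 then \<pi> ^ ?k else inverse (\<pi> ^ ?k)"
    show "?c \<noteq> 0" using \<pi> by simp
    show "v (to_ac ?c) = - of_int r"
      using \<pi> by (simp add: v_power v_inverse)
    have "w (P ^ j) = of_nat j" for j
      using P \<pi> by (simp add: W.v_power P_def)
    then show "w (ratfun_const (to_ac ?c)) = - of_int r"
      using \<pi> P by (simp add: const_power const_inverse W.v_inverse W.power_closed)
  qed
  define C where "C = ratfun_const (to_ac c)"
  have C: "C \<in> base_ratfuns" "C \<noteq> 0"
    using base_ratfuns_const c(1) by (auto simp: C_def ratfun_const_def Zero_fract_def eq_fract)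
  define k where "k = nat q"
  \<comment> \<open>Since \<open>v x = r / q\<close>, the value of \<open>\<psi>\<close> at
    \<open>s n\<close> has valuation \<open>q * v x - r = 0\<close>. So \<open>\<psi>\<close> is a
    unit of the common ring, and \<open>w \<psi> = 0\<close> reads
    \<open>q * w \<phi> = r\<close>.\<close>
  define \<psi> where "\<psi> = C * \<phi> ^ k"
  have stable: "index_stable \<psi> n"
    unfolding \<psi>_def C_def using c \<phi> by (intro index_stable_const_mult index_stable_power) auto
  have val: "has_value \<psi> (s n) (to_ac c * x ^ k)"
    unfolding \<psi>_def C_def using \<phi> by (intro has_value_mult has_value_power has_value_const)
  have nz: "to_ac c * x ^ k \<noteq> 0" using x c by simp
  have v0: "v (to_ac c * x ^ k) = 0"
    using x c rq by (simp add: v_mult v_power k_def)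
  have base: "\<psi> \<in> base_ratfuns" "\<psi> \<noteq> 0"
    using C \<phi> by (auto simp: \<psi>_def intro: W.mult_closed W.power_closed)
  have "\<psi> \<in> seq_ring v s"
    using index_stable_mem_iff(1)[OF stable val] v0 base seq_ring_eq_contraction by auto
  moreover have "inverse \<psi> \<in> seq_ring v s"
    using index_stable_mem_iff(1)[OF index_stable_inverse[OF stable] has_value_inverse[OF val nz]]
      v0 base seq_ring_eq_contraction v_inverse[OF _ nz] W.inverse_closed by auto
  ultimately have "0 \<le> w \<psi>" "0 \<le> w (inverse \<psi>)"
    using base by (auto simp: ring[symmetric] valuation_ring_def)
  then have "w \<psi> = 0" using W.v_inverse[OF base] by simp
  then have "of_int q * w \<phi> = of_int r"
    using C \<phi> c rq by (simp add: \<psi>_def W.v_mult W.v_power W.power_closed C_def k_def)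
  then show ?thesis using rq(1) unfolding rq(2) by (simp add: eq_divide_eq mult.commute)
qed

text \<open>Functions and values are paired as for the residue fields, and
  \<open>seq_valuation_eq\<close> equates the two valuations on each pair.\<close>

lemma value_groups_eq:
  assumes w: "valuation_on base_ratfuns w"
    and ring: "valuation_ring base_ratfuns w = seq_ring v s"
    and \<pi>: "\<pi> \<noteq> 0" "v (to_ac \<pi>) = 1" "w (ratfun_const (to_ac \<pi>)) = 1"
  shows "(\<Union>n. value_group (adjoin (s n)) v) = value_group base_ratfuns w"
proof -
  have "v y \<in> w ` (base_ratfuns - {0})" if y: "y \<in> adjoin (s n)" "y \<noteq> 0" for y n
  proof -
    obtain \<phi> where "\<phi> \<in> base_ratfuns" "\<phi> \<noteq> 0" "index_stable \<phi> n" "has_value \<phi> (s n) y"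
      using adjoin_value_index_stable[OF y] by blast
    with seq_valuation_eq[OF w ring \<pi> this] show ?thesis by (auto intro!: image_eqI[of _ _ \<phi>])
  qed
  moreover have "w \<phi> \<in> (\<Union>n. v ` (adjoin (s n) - {0}))"
    if \<phi>: "\<phi> \<in> base_ratfuns" "\<phi> \<noteq> 0" for \<phi>
  proof -
    from eventually_conj[OF eventually_value_in_adjoin eventually_index_stable, OF \<phi>]
    obtain n y where n: "y \<in> adjoin (s n)" "has_value \<phi> (s n) y" "index_stable \<phi> n"
      unfolding eventually_sequentially by blast
    then show ?thesis
      using seq_valuation_eq[OF w ring \<pi> \<phi> n(3,2)] index_stable_mem_iff(2)[OF n(3,2)] by blast
  qed
  ultimately show ?thesis unfolding value_group_def by blast
qed

end

theorem proposition2p7: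
  fixes p :: nat
    and vp :: "'k::field_char_0 \<Rightarrow> rat"
    and v :: "'k alg_closure \<Rightarrow> rat"
    and s :: "nat \<Rightarrow> 'k alg_closure"
    and w :: "'k alg_closure poly fract \<Rightarrow> rat"
  assumes p: "prime p"
    and Qp: "is_padic_field p vp"
    and v_valuation: "valuation_on UNIV v"
    and v_extends: "\<And>x. x \<noteq> 0 \<Longrightarrow> v (to_ac x) = vp x"
    and E: "stacked v s"
    and w_valuation: "valuation_on base_ratfuns w"
    and w_ring: "valuation_ring base_ratfuns w = seq_ring v s"
    and w_extends: "\<And>x. x \<noteq> 0 \<Longrightarrow> w (ratfun_const (to_ac x)) = vp x"
  shows "(\<Union>n. value_group (adjoin (s n)) v) = value_group base_ratfuns w \<and>
         (\<Union>n. residue_field_ext v s n) = residue_field_seq v s"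
proof -
  interpret stacked_sequence v s
    using v_valuation E by unfold_locales auto
  \<comment> \<open>The prime itself serves as \<open>\<pi>\<close>; these two facts give it
    multiplicity 1 in itself.\<close>
  have "int p \<noteq> 0" "\<not> is_unit (int p)"
    using p by (auto dest: prime_gt_1_nat)
  then have "vp (of_int (int p)) = 1"
    using Qp unfolding is_padic_field_def by (metis multiplicity_self of_nat_1)
  then have "v (to_ac (of_nat p)) = 1" "w (ratfun_const (to_ac (of_nat p))) = 1"
    using v_extends w_extends \<open>int p \<noteq> 0\<close> by (auto simp del: to_ac_of_nat)
  then show ?thesis
    using value_groups_eq[OF w_valuation w_ring, of "of_nat p"] residue_fields_eq \<open>int p \<noteq> 0\<close> by simp
qed

end
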